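(* Let $q$ be a prime power and $n, m$ positive integers. Let $\boldsymbol{b}=(b_1,\ldots,b_m)$ with $b_i\in\mathbb{F}_q^n$, let $T$ be an $m\times m$ full-rank matrix over $\mathbb{F}_q$, and let $\boldsymbol{b}'=(b'_1,\ldots,b'_m)=\boldsymbol{b}T$. Let $B=\{\!\{b_1,\ldots,b_m\}\!\}$ and $B'=\{\!\{b'_1,\ldots,b'_m\}\!\}$ be the multisets of entries of $\boldsymbol{b}$ and $\boldsymbol{b}'$, respectively. Then $\operatorname{mspan}_q(B)=\operatorname{mspan}_q(B')$.
   Context: A multiset $M$ over a universe $U$ is given by a multiplicity function $\mu_M\colon U\to\{0,1,2,\ldots\}$. For a finite multiset $B=\{\!\{b_1,\ldots,b_m\}\!\}$ over $\mathbb{F}_q^n$ (the $b_i$ are not necessarily distinct), the multispan $\operatorname{mspan}_q(B)$ is the multiset over $\mathbb{F}_q^n$ in which the multiplicity of $v$ is the number of $m$-tuples $(\alpha_1,\ldots,\alpha_m)\in\mathbb{F}_q^m$ with $\sum_{i=1}^m\alpha_i b_i=v$. The product $\boldsymbol{b}T$ is the row-vector-times-matrix product: $b'_j=\sum_{i=1}^m T_{ij}b_i$. *)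

theory Defs
  imports
    "HOL-Analysis.Analysis"
    "HOL-Library.Multiset"
    "HOL-Combinatorics.Permutations"
begin

text \<open>
  The field with \<open>q\<close> elements is a type \<open>'a\<close> of the classes \<open>field\<close> and \<open>finite\<close> (so
  \<open>q = CARD('a)\<close>, which is a prime power), and its \<open>n\<close>-fold power is \<open>'a ^ 'n\<close> with
  \<open>n = CARD('n) > 0\<close>. An \<open>m\<close>-tuple of coefficients is a list of length \<open>m\<close>.
\<close>

definition coeff_tuples :: "('a::field ^ 'n) list \<Rightarrow> 'a ^ 'n \<Rightarrow> 'a list set" where
  "coeff_tuples bs v =
     {as. length as = length bs \<and> (\<Sum>i<length bs. as ! i *s bs ! i) = v}"

text \<open>
  The finite multiset \<open>B\<close> is enumerated as a list in an arbitrary order; \<open>count_mspan\<close> below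
  shows that the choice is immaterial. The function passed to \<open>Abs_multiset\<close> has finite
  support because \<open>'a ^ 'n\<close> is a finite type.
\<close>

definition mspan :: "('a::{field,finite} ^ 'n) multiset \<Rightarrow> ('a ^ 'n) multiset" where
  "mspan B = Abs_multiset (\<lambda>v. card (coeff_tuples (SOME bs. mset bs = B) v))"

definition entries :: "'b ^ 'm \<Rightarrow> 'b multiset" where
  "entries b = image_mset (\<lambda>i. b $ i) (mset_set UNIV)"

text \<open>
  Row vector times matrix, as \<open>vector_matrix_mult\<close>, except that the entries of the row are
  themselves vectors over the field rather than scalars.
\<close>

definition row_times_matrix :: "('a::field ^ 'n) ^ 'm \<Rightarrow> 'a ^ 'k ^ 'm \<Rightarrow> ('a ^ 'n) ^ 'k" where
  "row_times_matrix b T = (\<chi> j. \<Sum>i\<in>UNIV. T $ i $ j *s b $ i)"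

lemma card_coeff_tuples_cong:
  fixes xs ys :: "('a::field ^ 'n) list"
  assumes "mset xs = mset ys"
  shows "card (coeff_tuples xs v) = card (coeff_tuples ys v)"
proof -
  obtain p where p: "p permutes {..<length ys}" and xs: "permute_list p ys = xs"
    using assms by (rule mset_eq_permutation)
  have len: "length xs = length ys"
    using assms by (rule mset_eq_length)
  have sums: "(\<Sum>i<length xs. permute_list p as ! i *s xs ! i) = (\<Sum>i<length ys. as ! i *s ys ! i)"
    if "length as = length ys" for as :: "'a list"
  proof -
    have "(\<Sum>i<length xs. permute_list p as ! i *s xs ! i) = (\<Sum>i<length ys. as ! p i *s ys ! p i)"
      using p that by (intro sum.cong) (auto simp: len xs[symmetric] permute_list_nth)
    also have "\<dots> = (\<Sum>i<length ys. as ! i *s ys ! i)"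
      by (rule sum.permute[OF p, symmetric, unfolded comp_def])
    finally show ?thesis .
  qed
  have "bij_betw (permute_list p) (coeff_tuples ys v) (coeff_tuples xs v)"
  proof (rule bij_betw_byWitness[where f' = "permute_list (inv p)"])
    have q: "inv p permutes {..<length ys}"
      using p by (rule permutes_inv)
    have inv1: "permute_list (inv p) (permute_list p as) = as"
      if "length as = length ys" for as :: "'a list"
      using permute_list_compose[of "inv p" as p] q that permutes_inv_o(1)[OF p]
      by simp
    have inv2: "permute_list p (permute_list (inv p) as) = as"
      if "length as = length ys" for as :: "'a list"
      using permute_list_compose[of p as "inv p"] p that permutes_inv_o(2)[OF p]
      by simp
    show "\<forall>as\<in>coeff_tuples ys v. permute_list (inv p) (permute_list p as) = as"
      by (simp add: coeff_tuples_def inv1)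
    show "\<forall>as\<in>coeff_tuples xs v. permute_list p (permute_list (inv p) as) = as"
      by (simp add: coeff_tuples_def inv2 len)
    show "permute_list p ` coeff_tuples ys v \<subseteq> coeff_tuples xs v"
      using sums by (auto simp: coeff_tuples_def len)
    show "permute_list (inv p) ` coeff_tuples xs v \<subseteq> coeff_tuples ys v"
    proof (rule image_subsetI)
      fix as assume "as \<in> coeff_tuples xs v"
      then show "permute_list (inv p) as \<in> coeff_tuples ys v"
        using sums[of "permute_list (inv p) as"] by (simp add: coeff_tuples_def len inv2)
    qed
  qed
  then show ?thesis
    by (metis bij_betw_same_card)
qed

lemma count_mspan:
  fixes bs :: "('a::{field,finite} ^ 'n) list"
  shows "count (mspan (mset bs)) v = card (coeff_tuples bs v)"
proof -
  have "mset (SOME cs. mset cs = mset bs) = mset bs"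
    by (rule someI[where P = "\<lambda>cs. mset cs = mset bs"]) (rule refl)
  then have "card (coeff_tuples (SOME cs. mset cs = mset bs) w) = card (coeff_tuples bs w)"
    for w :: "'a ^ 'n"
    by (rule card_coeff_tuples_cong)
  then show ?thesis
    unfolding mspan_def by (simp add: count_Abs_multiset)
qed

end

theory Submission
  imports Defs
begin

text \<open>Write a coefficient tuple as a column vector \<open>a\<close>, so that the multiplicity
  of \<open>v\<close> in the multispan is the size of the fibre over \<open>v\<close> of the map
  sending \<open>a\<close> to the product \<open>b a\<close> (\<open>count_mspan_entries\<close>).
  By associativity, (b T) a = b (T a) (\<open>row_combination_row_times_matrix\<close>), so the
  fibre for \<open>b'\<close> is the preimage under \<open>T\<close> of the fibre for
  \<open>b\<close>. A full-rank \<open>T\<close> permutes the coefficient vectors, so both fibres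
  have the same size.\<close>

definition row_combination :: "('a::field ^ 'n) ^ 'm \<Rightarrow> 'a ^ 'm \<Rightarrow> 'a ^ 'n" where
  "row_combination b a = (\<Sum>i\<in>UNIV. a $ i *s b $ i)"

text \<open>Associativity of the matrix product, obtained by exchanging two finite sums.\<close>

lemma row_combination_row_times_matrix:
  fixes b :: "('a::field ^ 'n) ^ 'm" and T :: "'a ^ 'k ^ 'm"
  shows "row_combination (row_times_matrix b T) a = row_combination b (T *v a)"
proof -
  have "row_combination (row_times_matrix b T) a
      = (\<Sum>j\<in>UNIV. \<Sum>i\<in>UNIV. (T $ i $ j * a $ j) *s b $ i)"
    by (simp add: row_combination_def row_times_matrix_def vec.scale_sum_right mult.commute)
  also have "\<dots> = (\<Sum>i\<in>UNIV. \<Sum>j\<in>UNIV. (T $ i $ j * a $ j) *s b $ i)"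
    by (rule sum.swap)
  also have "\<dots> = row_combination b (T *v a)"
    by (simp add: row_combination_def matrix_vector_mult_def vec.scale_sum_left)
  finally show ?thesis .
qed

text \<open>Passes from coefficient lists to vectors indexed by \<open>'m\<close>, on which
  \<open>T\<close> acts.\<close>

lemma count_mspan_entries:
  fixes b :: "('a::{field,finite} ^ 'n) ^ 'm"
  shows "count (mspan (entries b)) v = card (row_combination b -` {v})"
proof -
  \<comment> \<open>The indices are enumerated, not the entries: \<open>b\<close> may repeat values,
    and each occurrence carries its own coefficient.\<close>
  obtain xs :: "'m list" where xs: "set xs = UNIV" "distinct xs"
    using finite_distinct_list[OF finite_class.finite_UNIV] by blast
  define bs where "bs = map (($) b) xs"
  have nth: "bij_betw ((!) xs) {..<length xs} UNIV"
    using bij_betw_nth[OF xs(2) refl refl] xs(1) by simp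
  have "mset xs = mset_set UNIV"
    using xs by (metis mset_set_set)
  then have "entries b = mset bs"
    by (simp add: entries_def bs_def)
  moreover have "bij_betw (\<lambda>a. map (($) a) xs) (row_combination b -` {v}) (coeff_tuples bs v)"
    unfolding bij_betw_def
  proof (intro conjI equalityI subsetI)
    have sum: "(\<Sum>i<length bs. map (($) a) xs ! i *s bs ! i) = row_combination b a" for a :: "'a ^ 'm"
      unfolding row_combination_def sum.reindex_bij_betw[OF nth, symmetric]
      by (simp add: bs_def)
    show "inj_on (\<lambda>a. map (($) a) xs) (row_combination b -` {v})"
      by (rule inj_onI) (simp add: xs(1) vec_eq_iff)
    show "as \<in> coeff_tuples bs v" if "as \<in> (\<lambda>a. map (($) a) xs) ` (row_combination b -` {v})" for as
      using that sum by (auto simp: coeff_tuples_def bs_def)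
    show "as \<in> (\<lambda>a. map (($) a) xs) ` (row_combination b -` {v})" if as: "as \<in> coeff_tuples bs v" for as
    proof
      \<comment> \<open>Coordinate \<open>x\<close> receives the coefficient at the position of
        \<open>x\<close> in \<open>xs\<close>.\<close>
      define a :: "'a ^ 'm" where "a = (\<chi> x. as ! inv_into {..<length xs} ((!) xs) x)"
      have "length as = length xs"
        using as by (simp add: coeff_tuples_def bs_def)
      then show eq: "as = map (($) a) xs"
        using nth by (auto intro!: nth_equalityI simp: a_def bij_betw_def)
      show "a \<in> row_combination b -` {v}"
        using as sum[of a] by (simp add: coeff_tuples_def eq)
    qed
  qed
  ultimately show ?thesis
    by (simp add: count_mspan bij_betw_same_card)
qed

text \<open>\<open>rank\<close> is the dimension of the row span. It is maximal iff the rows span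
  the whole space, iff \<open>A\<close> has a left inverse, iff \<open>A\<close> is
  injective.\<close>

lemma full_rank_injective_field:
  fixes A :: "'a::field ^ 'n ^ 'm"
  shows "rank A = CARD('n) \<longleftrightarrow> inj ((*v) A)"
  by (simp add: matrix_left_invertible_injective [symmetric] matrix_left_invertible_span_rows_gen
      row_rank_def_gen vec.dim_eq_full [symmetric] card_cart_basis vec.dimension_def)

theorem proposition2p4:
  fixes b b' :: "('a::{field,finite} ^ 'n) ^ 'm"
    and T :: "'a ^ 'm ^ 'm"
  assumes "rank T = CARD('m)"
    and "b' = row_times_matrix b T"
  shows "mspan (entries b) = mspan (entries b')"
proof (rule multiset_eqI)
  fix v
  have "inj ((*v) T)"
    using assms(1) by (simp add: full_rank_injective_field)
  \<comment> \<open>An injective self-map of a finite set is surjective; surjectivity is what lets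
    preimages keep their cardinality.\<close>
  then have "bij ((*v) T)"
    by (simp add: bij_def finite_UNIV_inj_surj)
  moreover have "row_combination b' -` {v} = (*v) T -` (row_combination b -` {v})"
    using assms(2) by (auto simp: row_combination_row_times_matrix)
  ultimately show "count (mspan (entries b)) v = count (mspan (entries b')) v"
    by (simp add: count_mspan_entries card_vimage_inj bij_def)
qed

end
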